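(* Let $U$ be an orthogonal transformation of $\mathbb{R}^d$ and $P\subseteq\mathbb{R}^d$ a set with $P=UP^\circ$. Suppose $x\in\mathbb{R}^d$ satisfies $U^2x=x$ and $[(P\cap U\{x\}^\circ)\cup\{x\}]=[P\cup\{x\}]\cap U\{x\}^\circ$. Then the set $Q=[P\cup\{x\}]\cap U\{x\}^\circ$ satisfies $Q=UQ^\circ$.
   Context: For $A\subseteq\mathbb{R}^d$, the polar is $A^\circ=\{y\in\mathbb{R}^d:\langle y,a\rangle\le 1\text{ for all }a\in A\}$ (so $\{x\}^\circ$ is the halfspace $\{y:\langle y,x\rangle\le 1\}$), and $[A]$ denotes the Euclidean closure of the convex hull of $A\cup\{0\}$. An orthogonal transformation is a linear map $U$ with $U^T=U^{-1}$. *)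

theory Defs
  imports "HOL-Analysis.Analysis"
begin

definition polar :: "'a::real_inner set \<Rightarrow> 'a set" where
  "polar A = {y. \<forall>a\<in>A. y \<bullet> a \<le> 1}"

text \<open>The set written \<open>[A]\<close>.\<close>

definition hull0 :: "'a::real_normed_vector set \<Rightarrow> 'a set" where
  "hull0 A = closure (convex hull (A \<union> {0}))"

end

theory Submission
  imports Defs
begin

text \<open>
  By the bipolar theorem \<open>[A] = A\<degree>\<degree>\<close>, so everything reduces to polar calculus. Since \<open>P\<close> is itself
  a polar, \<open>P = P\<degree>\<degree>\<close>, and polarising \<open>P = U P\<degree>\<close> gives \<open>U P = P\<degree>\<close>. With \<open>H = U {x}\<degree>\<close> the
  hypothesis on hulls yields \<open>Q\<degree> = ((P \<inter> H) \<union> {x})\<degree>\<close>, hence \<open>U Q\<degree> = (U (P \<inter> H))\<degree> \<inter> H\<close>, and \<open>U\<^sup>2 x = x\<close>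
  turns \<open>U (P \<inter> H)\<close> into \<open>P\<degree> \<inter> {x}\<degree> = (P \<union> {x})\<degree>\<close>.
\<close>

lemma polar_Un: "polar (A \<union> B) = polar A \<inter> polar B"
  by (auto simp: polar_def)

lemma polar_antimono: "A \<subseteq> B \<Longrightarrow> polar B \<subseteq> polar A"
  by (auto simp: polar_def)

lemma subset_bipolar: "A \<subseteq> polar (polar A)"
  by (auto simp: polar_def inner_commute)

lemma polar_polar_polar: "polar (polar (polar A)) = polar A"
  using subset_bipolar[of "polar A"] polar_antimono[OF subset_bipolar[of A]] by blast

lemma polar_eq_Inter: "polar A = (\<Inter>a\<in>A. {y. a \<bullet> y \<le> 1})"
  by (auto simp: polar_def inner_commute)

lemma closed_polar: "closed (polar A)"
  unfolding polar_eq_Inter by (intro closed_INT ballI closed_halfspace_le)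

lemma convex_polar: "convex (polar A)"
  unfolding polar_eq_Inter by (intro convex_INT convex_halfspace_le)

lemma zero_in_polar: "0 \<in> polar A"
  by (simp add: polar_def)

text \<open>Bipolars are closed, convex and contain 0. Conversely, a point outside the closed convex
  set \<open>hull0 A\<close> is strictly separated from it, and the rescaled normal is an element of
  \<open>polar A\<close> that excludes the point.\<close>

theorem bipolar:
  fixes A :: "'a::euclidean_space set"
  shows "polar (polar A) = hull0 A"
proof
  have "A \<union> {0} \<subseteq> polar (polar A)"
    using subset_bipolar zero_in_polar by blast
  then show "hull0 A \<subseteq> polar (polar A)"
    unfolding hull0_def
    by (intro closure_minimal hull_minimal closed_polar convex_polar)
  show "polar (polar A) \<subseteq> hull0 A"
  proof
    fix z assume z: "z \<in> polar (polar A)"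
    show "z \<in> hull0 A"
    proof (rule ccontr)
      assume "z \<notin> hull0 A"
      moreover have "convex (hull0 A)" "closed (hull0 A)"
        unfolding hull0_def by auto
      ultimately obtain a b where ab: "a \<bullet> z < b" "\<And>y. y \<in> hull0 A \<Longrightarrow> b < a \<bullet> y"
        using separating_hyperplane_closed_point[of "hull0 A" z] by auto
      have sub: "A \<union> {0} \<subseteq> hull0 A"
        unfolding hull0_def using hull_subset closure_subset by (rule subset_trans)
      have b: "b < 0"
        using ab(2)[of 0] sub by simp
      \<comment> \<open>Dividing by the negative \<open>b\<close> reverses both inequalities:
        \<open>w\<close> has inner product below 1 with every point of \<open>A\<close> and above 1
        with \<open>z\<close>.\<close>
      define w where "w = (1 / b) *\<^sub>R a"
      have "w \<in> polar A"
        unfolding polar_def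
      proof (intro CollectI ballI)
        fix y assume "y \<in> A"
        then have "b < a \<bullet> y"
          using ab(2) sub by blast
        then show "w \<bullet> y \<le> 1"
          using b by (simp add: w_def divide_simps)
      qed
      with z have "z \<bullet> w \<le> 1"
        by (simp add: polar_def)
      then show False
        using ab(1) b by (simp add: w_def inner_commute divide_simps)
    qed
  qed
qed

text \<open>By surjectivity every point is some \<open>U v\<close>, and as \<open>U\<close>
  preserves inner products the polar condition pulls back to \<open>v\<close>.\<close>

lemma polar_orthogonal_image:
  fixes U :: "'a::euclidean_space \<Rightarrow> 'a"
  assumes "orthogonal_transformation U"
  shows "polar (U ` A) = U ` polar A"
proof -
  have "surj U" and inner: "\<And>v w. U v \<bullet> U w = v \<bullet> w"
    using assms by (auto simp: orthogonal_transformation_surj orthogonal_transformation_def)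
  show ?thesis
  proof (intro equalityI subsetI)
    fix y assume y: "y \<in> polar (U ` A)"
    obtain v where "y = U v"
      using \<open>surj U\<close> by blast
    with y show "y \<in> U ` polar A"
      by (auto simp: polar_def inner)
  qed (auto simp: polar_def inner)
qed

theorem theorem7p3:
  fixes U :: "real ^ 'n \<Rightarrow> real ^ 'n"
    and P Q :: "(real ^ 'n) set"
    and x :: "real ^ 'n"
  assumes "orthogonal_transformation U"
    and "P = U ` polar P"
    and "U (U x) = x"
    and "hull0 ((P \<inter> U ` polar {x}) \<union> {x}) = hull0 (P \<union> {x}) \<inter> U ` polar {x}"
    and "Q = hull0 (P \<union> {x}) \<inter> U ` polar {x}"
  shows "Q = U ` polar Q"
proof -
  note image = polar_orthogonal_image[OF assms(1), symmetric]
  let ?H = "U ` polar {x}"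
  have "P = polar (U ` P)"
    using assms(2) image by (rule trans)
  then have "polar (polar P) = P"
    by (metis polar_polar_polar)
  then have UP: "U ` P = polar P"
    using arg_cong[OF assms(2), of polar] image[of "polar P"] image[of P] by metis
  \<comment> \<open>Moving \<open>U\<close> inside the polar twice gives the polar of
    \<open>{U (U x)}\<close>.\<close>
  have UH: "U ` ?H = polar {x}"
    using assms(3) by (simp add: image)
  have "inj U"
    using assms(1) by (rule orthogonal_transformation_inj)
  then have UPH: "U ` (P \<inter> ?H) = polar (P \<union> {x})"
    by (simp only: image_Int UP UH polar_Un)
  \<comment> \<open>The hull hypothesis turns the intersection defining \<open>Q\<close> into a
    bipolar, whose polar is a single polar and splits over the union.\<close>
  have "Q = polar (polar ((P \<inter> ?H) \<union> {x}))"
    using assms(4,5) by (simp add: bipolar)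
  then have "polar Q = polar (P \<inter> ?H) \<inter> polar {x}"
    by (metis polar_polar_polar polar_Un)
  then have "U ` polar Q = U ` polar (P \<inter> ?H) \<inter> ?H"
    by (simp only: image_Int[OF \<open>inj U\<close>])
  also have "\<dots> = polar (U ` (P \<inter> ?H)) \<inter> ?H"
    by (simp only: polar_orthogonal_image[OF assms(1)])
  also have "\<dots> = Q"
    unfolding UPH bipolar by (rule assms(5)[symmetric])
  finally show ?thesis
    by (rule sym)
qed

end
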